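(* Let $p$ be a prime and $q=1/p$. For integers $n\ge 1$ and $\mu\ge 1$, let $P(n,p^\mu)$ denote the probability that a random symmetric $n\times n$ matrix $A$ over $\mathbf{Z}_{p^\mu}$ satisfies $\det(A)\not\equiv 0 \pmod{p^\mu}$. Let $k=\lfloor n/2\rfloor$ and $s=\lfloor(\mu-1)/2\rfloor$. Then $$P(n,p^\mu)=\frac{\Pi_{2k}(q)}{(1-q)\,\Pi_k(q^2)}\Big((1-q^{2k+1})\,T_3(k,s)-q^\mu(1-q^n)\,T_1(k,s)\Big).$$
   Context: For a positive integer $m$, $\mathbf{Z}_m=\{1,2,\ldots,m\}$ (viewed as residues mod $m$). A random symmetric $n\times n$ matrix over $\mathbf{Z}_m$ is one whose entries $a_{ij}$, $i\le j$, are chosen independently and uniformly from $\mathbf{Z}_m$, with $a_{ji}=a_{ij}$. For $n\ge 0$, $\Pi_n(q)=\prod_{j=1}^n(1-q^j)$ (so $\Pi_0=1$). For $\beta\in\{1,3\}$, $k\ge0$, $s\ge 0$: $T_\beta(k,0\text{-case})$ is defined by $T_\beta(k,s)=1$ if $k=0$, and $T_\beta(k,s)=\sum_{j=0}^{s} q^{\beta j}\,\frac{\Pi_{k+j-1}(q^2)}{\Pi_j(q^2)\,\Pi_{k-1}(q^2)}$ if $k\ge 1$. *)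

theory Defs
  imports "Jordan_Normal_Form.Determinant"
begin

text \<open>Random symmetric n x n matrices over Z_m: entries a_ij (i \<le> j) uniform in {1..m},
  a_ji = a_ij. Equivalently, the uniform distribution on the finite set below.\<close>
definition sym_mats :: "nat \<Rightarrow> nat \<Rightarrow> int mat set" where
  "sym_mats n m = {A \<in> carrier_mat n n.
      (\<forall>i<n. \<forall>j<n. A $$ (i,j) = A $$ (j,i)) \<and>
      (\<forall>i<n. \<forall>j<n. A $$ (i,j) \<in> {1..int m})}"

definition P_nonsing :: "nat \<Rightarrow> nat \<Rightarrow> real" where
  "P_nonsing n m = real (card {A \<in> sym_mats n m. \<not> (int m dvd det A)}) / real (card (sym_mats n m))"

definition Pi_q :: "nat \<Rightarrow> real \<Rightarrow> real" where
  "Pi_q n q = (\<Prod>j=1..n. 1 - q ^ j)"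

definition T_beta :: "nat \<Rightarrow> nat \<Rightarrow> nat \<Rightarrow> real \<Rightarrow> real" where
  "T_beta \<beta> k s q = (if k = 0 then 1 else
     (\<Sum>j=0..s. q ^ (\<beta> * j) * Pi_q (k + j - 1) (q^2) / (Pi_q j (q^2) * Pi_q (k - 1) (q^2))))"

end

theory Submission
  imports Defs "HOL-Number_Theory.Cong"
begin

text \<open>Let \<open>P(n, \<mu>)\<close> be the probability. Look at the first row \<open>(a, v)\<close> of a random matrix. If \<open>a\<close> is a
  unit, a Schur complement leaves a uniform matrix of size \<open>n - 1\<close>. If \<open>p\<close> divides \<open>a\<close> but not all of
  \<open>v\<close>, a two by two pivot leaves a uniform matrix of size \<open>n - 2\<close>. If the whole row is divisible by
  \<open>p\<close>, take \<open>p\<close> out of the row: either \<open>a / p\<close> is a unit, and a Schur complement leaves size \<open>n - 1\<close>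
  and exponent \<open>\<mu> - 1\<close>, or another \<open>p\<close> comes out of the first column and what remains is uniform of
  size \<open>n\<close> modulo \<open>p^(\<mu> - 2)\<close>. Hence
  \<open>P(n, \<mu>) = (1 - q) P(n - 1, \<mu>) + q (1 - q^(n - 1)) P(n - 2, \<mu>) + q^n ((1 - q) P(n - 1, \<mu> - 1) + q P(n, \<mu> - 2))\<close>,
  and the two Pascal rules for Gaussian binomial coefficients show that the closed form satisfies the
  same recursion.\<close>

subsection \<open>Recursion for the closed form\<close>

text \<open>The recursion for the closed form, with the common factor cancelled, in its four parity cases
  (\<open>n\<close> and \<open>\<mu>\<close> even or odd). Here \<open>x = q^(2k)\<close>, \<open>Q = q^s\<close>, \<open>A\<^sub>\<beta>\<close> and \<open>B\<^sub>\<beta>\<close> are the sums for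
  \<open>k + 1\<close> and \<open>k\<close> truncated before \<open>j = s\<close>, and \<open>t\<close>, \<open>t'\<close> are the coefficients at \<open>j = s\<close>.\<close>

lemma step_even_even:
  fixes q x Q A1 A3 B1 B3 t t' :: real
  assumes "B1 = A1 * (1 - x * q) + Q * (t - t')" "B3 = A3 * (1 - x * q^3) + Q^3 * (t - t')"
    "(1 - q) * A1 + Q * t = B3 + Q^3 * t'"
    "t * (1 - x) = t' * (1 - x * Q^2)"
  shows "(1 - x * q) * ((1 - x * q^3) * (A3 + Q^3 * t) - Q^2 * q^2 * (1 - x * q^2) * (A1 + Q * t))
   = (1 - q) * ((1 - x * q) * (B3 + Q^3 * t') - Q^2 * q^2 * (1 - x * q) * (B1 + Q * t'))
   + q * (1 - x * q) * ((1 - x * q) * (B3 + Q^3 * t') - Q^2 * q^2 * (1 - x) * (B1 + Q * t'))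
   + x * q^2 * ((1 - q) * ((1 - x * q) * (B3 + Q^3 * t') - Q^2 * q * (1 - x * q) * (B1 + Q * t'))
    + q * (1 - x * q) * ((1 - x * q^3) * A3 - Q^2 * (1 - x * q^2) * A1))"
  using assms by Groebner_Basis.algebra

lemma step_even_odd:
  fixes q x Q A1 A3 B1 B3 t t' z :: real
  assumes "B1 = A1 * (1 - x * q) + Q * (t - t')" "B3 = A3 * (1 - x * q^3) + Q^3 * (t - t')"
    "(1 - q) * A1 + Q * t = B3 + Q^3 * t'"
    "t * (1 - x) = t' * (1 - x * Q^2)" "z * q = Q^2"
  shows "(1 - x * q) * ((1 - x * q^3) * (A3 + Q^3 * t) - Q^2 * q * (1 - x * q^2) * (A1 + Q * t))
   = (1 - q) * ((1 - x * q) * (B3 + Q^3 * t') - Q^2 * q * (1 - x * q) * (B1 + Q * t'))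
   + q * (1 - x * q) * ((1 - x * q) * (B3 + Q^3 * t') - Q^2 * q * (1 - x) * (B1 + Q * t'))
   + x * q^2 * ((1 - q) * ((1 - x * q) * B3 - Q^2 * (1 - x * q) * B1)
    + q * (1 - x * q) * ((1 - x * q^3) * A3 - z * (1 - x * q^2) * A1))"
  using assms by Groebner_Basis.algebra

lemma step_odd_even:
  fixes q x Q A1 A3 B1 B3 t t' :: real
  assumes "B1 = A1 * (1 - x * q) + Q * (t - t')" "B3 = A3 * (1 - x * q^3) + Q^3 * (t - t')"
    "(1 - q) * A1 + Q * t = B3 + Q^3 * t'"
    "t * (1 - x) = t' * (1 - x * Q^2)"
  shows "(1 - x * q) * ((1 - x * q^3) * (A3 + Q^3 * t) - Q^2 * q^2 * (1 - x * q^3) * (A1 + Q * t))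
   = (1 - q) * (1 - x * q) * ((1 - x * q^3) * (A3 + Q^3 * t) - Q^2 * q^2 * (1 - x * q^2) * (A1 + Q * t))
   + q * (1 - x * q^2) * ((1 - x * q) * (B3 + Q^3 * t') - Q^2 * q^2 * (1 - x * q) * (B1 + Q * t'))
   + x * q^3 * ((1 - q) * (1 - x * q) * ((1 - x * q^3) * (A3 + Q^3 * t) - Q^2 * q * (1 - x * q^2) * (A1 + Q * t))
    + q * (1 - x * q) * ((1 - x * q^3) * A3 - Q^2 * (1 - x * q^3) * A1))"
  using assms by Groebner_Basis.algebra

lemma step_odd_odd:
  fixes q x Q A1 A3 B1 B3 t t' z :: real
  assumes "B1 = A1 * (1 - x * q) + Q * (t - t')" "B3 = A3 * (1 - x * q^3) + Q^3 * (t - t')"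
    "(1 - q) * A1 + Q * t = B3 + Q^3 * t'"
    "t * (1 - x) = t' * (1 - x * Q^2)" "z * q = Q^2"
  shows "(1 - x * q) * ((1 - x * q^3) * (A3 + Q^3 * t) - Q^2 * q * (1 - x * q^3) * (A1 + Q * t))
   = (1 - q) * (1 - x * q) * ((1 - x * q^3) * (A3 + Q^3 * t) - Q^2 * q * (1 - x * q^2) * (A1 + Q * t))
   + q * (1 - x * q^2) * ((1 - x * q) * (B3 + Q^3 * t') - Q^2 * q * (1 - x * q) * (B1 + Q * t'))
   + x * q^3 * ((1 - q) * (1 - x * q) * ((1 - x * q^3) * A3 - Q^2 * (1 - x * q^2) * A1)
    + q * (1 - x * q) * ((1 - x * q^3) * A3 - z * (1 - x * q^3) * A1))"
  using assms by Groebner_Basis.algebra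

text \<open>The Gaussian binomial coefficient of \<open>k + j - 1\<close> over \<open>j\<close> in base \<open>q^2\<close>; the value at \<open>k = 0\<close> keeps
  both Pascal rules valid from \<open>k = 0\<close> on.\<close>
definition qbinom :: "nat \<Rightarrow> nat \<Rightarrow> real \<Rightarrow> real" where
  "qbinom k j q = (if k = 0 then of_bool (j = 0)
     else Pi_q (k + j - 1) (q^2) / (Pi_q j (q^2) * Pi_q (k - 1) (q^2)))"

text \<open>\<open>T\<^sub>\<beta>(k, s)\<close> is \<open>qsum \<beta> k (s + 1)\<close>: the shift makes the closed form vanish at \<open>\<mu> = 0\<close>, as the
  recursion requires.\<close>
definition qsum :: "nat \<Rightarrow> nat \<Rightarrow> nat \<Rightarrow> real \<Rightarrow> real" where
  "qsum \<beta> k s q = (\<Sum>j<s. q ^ (\<beta> * j) * qbinom k j q)"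

section \<open>Pascal rules for Gaussian binomials and their truncated sums\<close>

lemma qsum_0 [simp]: "qsum \<beta> k 0 q = 0"
  by (simp add: qsum_def)

lemma qsum_Suc: "qsum \<beta> k (Suc s) q = qsum \<beta> k s q + q ^ (\<beta> * s) * qbinom k s q"
  by (simp add: qsum_def)

lemma Pi_q_0 [simp]: "Pi_q 0 q = 1"
  by (simp add: Pi_q_def)

lemma Pi_q_Suc: "Pi_q (Suc n) q = Pi_q n q * (1 - q ^ Suc n)"
  by (simp add: Pi_q_def)

lemma power_Suc_neq_1:
  fixes q :: real
  assumes "0 < q" "q < 1"
  shows "q ^ Suc n \<noteq> 1"
  using power_Suc_less_one[of q n] assms by simp

lemma Pi_q_nonzero:
  assumes "0 < q" "q < 1"
  shows "Pi_q n q \<noteq> 0"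
  using power_Suc_neq_1[OF assms] by (induction n) (auto simp: Pi_q_Suc simp del: power_Suc)

lemma square_unit_interval: "0 < q^2 \<and> q^2 < (1::real)" if "0 < q" "q < 1"
  using that by (simp add: power_less_one_iff)

lemma qbinom_0 [simp]:
  assumes "0 < q" "q < 1"
  shows "qbinom k 0 q = 1"
  using square_unit_interval[OF assms] Pi_q_nonzero[of "q^2"] by (simp add: qbinom_def)

lemma qbinom_0_Suc [simp]: "qbinom 0 (Suc j) q = 0"
  by (simp add: qbinom_def)

text \<open>For \<open>k > 0\<close> put \<open>u = q^(2(j+1))\<close> and
  \<open>v = q^(2k)\<close>. Over a common denominator the two rules become
  \<open>1 - u*v = (1 - v) + v*(1 - u)\<close> and
  \<open>1 - u*v = u*(1 - v) + (1 - u)\<close>.\<close>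

lemma qbinom_pascal:
  assumes q: "0 < q" "q < 1"
  shows "qbinom (Suc k) (Suc j) q = qbinom k (Suc j) q + q ^ (2*k) * qbinom (Suc k) j q" (is ?A)
    and "qbinom (Suc k) (Suc j) q = q ^ (2 * Suc j) * qbinom k (Suc j) q + qbinom (Suc k) j q" (is ?B)
proof -
  have nz: "Pi_q n (q^2) \<noteq> 0" for n
    using Pi_q_nonzero[of "q^2"] square_unit_interval[OF q] by auto
  have "?A \<and> ?B"
  proof (cases k)
    case 0
    then show ?thesis using nz by (simp add: qbinom_def)
  next
    case (Suc l)
    define u v where "u = (q^2) ^ Suc j" and "v = (q^2) ^ Suc l"
    have uv: "u \<noteq> 1" "v \<noteq> 1" "(q^2) ^ Suc (Suc (l + j)) = u * v"
      unfolding u_def v_def using power_Suc_neq_1[of "q^2"] square_unit_interval[OF q]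
      by (auto simp: power_add simp del: power_Suc) (simp add: power_add)
    define a b c where "a = Pi_q (Suc (l + j)) (q^2)" and "b = Pi_q j (q^2)" and "c = Pi_q l (q^2)"
    have abc: "a \<noteq> 0" "b \<noteq> 0" "c \<noteq> 0" using nz by (simp_all add: a_def b_def c_def)
    have 1: "qbinom (Suc k) (Suc j) q = a * (1 - u * v) / (b * (1 - u) * (c * (1 - v)))"
      unfolding qbinom_def Suc by (simp add: Pi_q_Suc[of "Suc (l + j)"] Pi_q_Suc[of j] Pi_q_Suc[of l] uv(3)
          flip: a_def b_def c_def u_def v_def del: power_Suc)
    have 2: "qbinom k (Suc j) q = a / (b * (1 - u) * c)"
      unfolding qbinom_def Suc by (simp add: Pi_q_Suc[of j] flip: a_def b_def c_def u_def del: power_Suc)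
    have 3: "qbinom (Suc k) j q = a / (b * (c * (1 - v)))"
      unfolding qbinom_def Suc by (simp add: Pi_q_Suc[of l] flip: a_def b_def c_def v_def del: power_Suc)
    have 4: "q ^ (2 * k) = v" "q ^ (2 * Suc j) = u"
      unfolding u_def v_def Suc by (simp_all only: power_mult)
    show ?thesis unfolding 1 2 3 4 using uv abc
      by (auto simp: divide_simps) (auto simp: algebra_simps)
  qed
  then show ?A ?B by auto
qed

text \<open>Eliminate the coefficient with lower index \<open>j - 1\<close> between the two Pascal
  rules. The product form also covers \<open>k = 0\<close>, where \<open>1 - q^(2k)\<close>
  vanishes.\<close>

lemma qbinom_Suc_left:
  assumes "0 < q" "q < 1"
  shows "qbinom (Suc k) j q * (1 - q ^ (2*k)) = qbinom k j q * (1 - q ^ (2*k) * (q ^ j)\<^sup>2)"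
proof (cases j)
  case 0
  then show ?thesis using assms by simp
next
  case (Suc i)
  have "q ^ (2 * Suc i) = (q ^ Suc i)\<^sup>2" by (simp only: power_mult[symmetric] mult.commute)
  moreover have "a * (1 - y) = b * (1 - y * w)" if "a = b + y * c" "a = w * b + c" for a b c w y :: real
    using that by Groebner_Basis.algebra
  ultimately show ?thesis
    unfolding Suc using qbinom_pascal[OF assms, of k i] by metis
qed

text \<open>The first Pascal rule summed with weights \<open>q^(\<beta>*j)\<close>; shifting
  \<open>j\<close> by one produces the extra factor \<open>q^\<beta>\<close>.\<close>

lemma qsum_Suc_left:
  assumes "0 < q" "q < 1"
  shows "qsum \<beta> (Suc k) (Suc s) q = qsum \<beta> k (Suc s) q + q ^ (2*k + \<beta>) * qsum \<beta> (Suc k) s q"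
proof (induction s)
  case 0
  then show ?case using assms by (simp add: qsum_Suc)
next
  case (Suc s)
  have "q ^ (\<beta> * Suc s) * (q ^ (2*k) * qbinom (Suc k) s q) = q ^ (2*k+\<beta>) * (q ^ (\<beta> * s) * qbinom (Suc k) s q)"
    by (simp add: power_add)
  then have "qsum \<beta> (Suc k) (Suc (Suc s)) q = qsum \<beta> k (Suc s) q + q ^ (2*k+\<beta>) * qsum \<beta> (Suc k) s q
      + (q ^ (\<beta> * Suc s) * qbinom k (Suc s) q + q ^ (2*k+\<beta>) * (q ^ (\<beta> * s) * qbinom (Suc k) s q))"
    unfolding qsum_Suc[of \<beta> "Suc k" "Suc s"] Suc.IH qbinom_pascal(1)[OF assms] by (simp only: distrib_left)
  then show ?case
    unfolding qsum_Suc[of \<beta> k "Suc s"] qsum_Suc[of \<beta> "Suc k" s] by (simp only: distrib_left add_ac)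
qed

text \<open>The second Pascal rule summed with weights \<open>q^j\<close>: its factor
  \<open>q^(2j)\<close> turns them into \<open>q^(3j)\<close>. This is the link between the sums for
  1 and for 3.\<close>

lemma qsum_1_3:
  assumes "0 < q" "q < 1"
  shows "qsum 1 (Suc k) (Suc s) q = q * qsum 1 (Suc k) s q + qsum 3 k (Suc s) q"
proof (induction s)
  case 0
  then show ?case using assms by (simp add: qsum_Suc)
next
  case (Suc s)
  have "q ^ (1 * Suc s) * q ^ (2 * Suc s) = q ^ (3 * Suc s)"
    unfolding power_add[symmetric] by (rule arg_cong[where f = "power q"]) simp
  then have "q ^ (1 * Suc s) * (q ^ (2 * Suc s) * qbinom k (Suc s) q) = q ^ (3 * Suc s) * qbinom k (Suc s) q"
    by (metis mult.assoc)
  then have "qsum 1 (Suc k) (Suc (Suc s)) q = q * qsum 1 (Suc k) s q + qsum 3 k (Suc s) q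
      + (q ^ (3 * Suc s) * qbinom k (Suc s) q + q * (q ^ (1 * s) * qbinom (Suc k) s q))"
    unfolding qsum_Suc[of 1 "Suc k" "Suc s"] Suc.IH qbinom_pascal(2)[OF assms] distrib_left by simp
  then show ?case
    unfolding qsum_Suc[of 3 k "Suc s"] qsum_Suc[of 1 "Suc k" s] by (simp only: distrib_left add_ac)
qed

section \<open>The closed form and its recursion\<close>

text \<open>For \<open>m > 0\<close> the exclusive bound \<open>(m + 1) div 2\<close> is one more
  than the inclusive bound \<open>(m - 1) div 2\<close> of the theorem; for \<open>m = 0\<close> the
  sums are empty.\<close>

definition formula :: "nat \<Rightarrow> nat \<Rightarrow> real \<Rightarrow> real" where
  "formula n m q = (let k = n div 2; s = (m + 1) div 2 in
     Pi_q (2*k) q / ((1 - q) * Pi_q k (q^2)) *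
       ((1 - q ^ (2*k+1)) * qsum 3 k s q - q ^ m * (1 - q ^ n) * qsum 1 k s q))"

lemma formula_0_left:
  assumes "0 < q" "q < 1" "m > 0"
  shows "formula 0 m q = 1"
proof -
  obtain s where s: "(m + 1) div 2 = Suc s" using assms(3) by (cases "(m + 1) div 2") auto
  have "qsum \<beta> 0 (Suc s) q = 1" for \<beta>
    by (induction s) (use assms in \<open>simp_all add: qsum_Suc\<close>)
  then show ?thesis using assms s by (simp add: formula_def)
qed

lemma formula_1_left:
  assumes "0 < q" "q < 1"
  shows "formula (Suc 0) m q = 1 - q ^ m"
proof (cases "m = 0")
  case False
  then obtain s where s: "(m + 1) div 2 = Suc s" by (cases "(m + 1) div 2") auto
  have "qsum \<beta> 0 (Suc s) q = 1" for \<beta>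
    by (induction s) (use assms in \<open>simp_all add: qsum_Suc\<close>)
  then show ?thesis using assms s by (simp add: formula_def divide_simps) (simp add: algebra_simps)
qed (simp add: formula_def)

lemma formula_0_right: "formula n 0 q = 0"
  by (simp add: formula_def)

text \<open>Every term is a multiple of one factor \<open>C\<close> and is expressed through the
  sums and coefficients for \<open>Suc k\<close> and \<open>k\<close>. The relations
  \<open>r\<close> between these reduce each parity case to one of the four polynomial
  identities.\<close>

lemma formula_rec:
  assumes q: "0 < q" "q < 1" and m: "m > 0"
  shows "formula (Suc n) m q = (1 - q) * formula n m q + q * (1 - q ^ n) * formula (n - 1) m q
     + q ^ Suc n * ((1 - q) * formula n (m - 1) q + q * formula (Suc n) (m - 2) q)"
proof (cases n)
  case 0
  \<comment> \<open>For \<open>n = 0\<close> the term with \<open>n - 1\<close> has coefficient 0.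
    The values of \<open>m\<close> are separated because \<open>m - 1\<close> or
    \<open>m - 2\<close> can be 0, where the closed form jumps to 0.\<close>
  consider "m = 1" | "m = 2" | l where "m = Suc (Suc (Suc l))"
    using m by (metis One_nat_def Suc_1 not_gr_zero not0_implies_Suc)
  then show ?thesis
    by cases (use q in \<open>simp_all add: 0 formula_1_left formula_0_left formula_0_right algebra_simps power2_eq_square\<close>)
next
  case (Suc n')
  define k where "k = n' div 2"
  define s where "s = (m - 1) div 2"
  define x where "x = q ^ (2 * k)"
  define Q where "Q = q ^ s"
  define A1 A3 B1 B3 t t' where
    "A1 = qsum 1 (Suc k) s q" and "A3 = qsum 3 (Suc k) s q" and
    "B1 = qsum 1 k s q" and "B3 = qsum 3 k s q" and
    "t = qbinom (Suc k) s q" and "t' = qbinom k s q"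
  define C where "C = Pi_q (2*k) q / ((1 - q) * Pi_q k (q^2))"
  \<comment> \<open>From \<open>k\<close> to \<open>k + 1\<close> the numerator gains two factors,
    of which \<open>1 - q^(2k+2)\<close> cancels against the denominator;
    \<open>1 - q^(2k+1)\<close> remains.\<close>
  have C': "Pi_q (2 * Suc k) q / ((1 - q) * Pi_q (Suc k) (q^2)) = C * (1 - x * q)"
  proof -
    have "q ^ Suc (Suc (2*k)) = (q^2) ^ Suc k"
      by (simp add: power_mult power2_eq_square)
    moreover have "(q^2) ^ Suc k \<noteq> 1" 
      using power_Suc_neq_1[of "q^2" k] square_unit_interval[OF q] by blast
    ultimately show ?thesis 
      by (simp add: C_def x_def Pi_q_Suc mult.commute del: power_Suc) (simp add: mult.commute)
  qed
  have sums: "qsum 1 (Suc k) (Suc s) q = A1 + Q * t" "qsum 3 (Suc k) (Suc s) q = A3 + Q ^ 3 * t"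
    "qsum 1 k (Suc s) q = B1 + Q * t'" "qsum 3 k (Suc s) q = B3 + Q ^ 3 * t'"
    by (simp_all add: qsum_Suc A1_def A3_def B1_def B3_def t_def t'_def Q_def power_mult[symmetric] mult.commute)
  have xp: "q ^ (2 * k + 1) = x * q" "q ^ (2 * k + 3) = x * q ^ 3"
    by (simp_all add: x_def power_add)
  have r: "B1 = A1 * (1 - x * q) + Q * (t - t')" "B3 = A3 * (1 - x * q ^ 3) + Q ^ 3 * (t - t')"
    "(1 - q) * A1 + Q * t = B3 + Q ^ 3 * t'" "t * (1 - x) = t' * (1 - x * Q^2)"
    using qsum_Suc_left[OF q, of 1 k s] qsum_Suc_left[OF q, of 3 k s] qsum_1_3[OF q, of k s]
      qbinom_Suc_left[OF q, of k s]
    unfolding sums xp A1_def[symmetric] A3_def[symmetric] t_def[symmetric] t'_def[symmetric]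
      x_def[symmetric] Q_def[symmetric]
    by (simp_all add: algebra_simps)
  have xs: "q ^ (2 * k) = x" "q ^ Suc (2 * k) = x * q" "q ^ Suc (Suc (2 * k)) = x * q ^ 2"
      "q ^ Suc (Suc (Suc (2 * k))) = x * q ^ 3" "q ^ (2 * Suc k) = x * q ^ 2"
      "q ^ Suc (2 * Suc k) = x * q ^ 3"
    by (simp_all add: x_def power2_eq_square power3_eq_cube)
  have Qs: "q ^ (2 * s) = Q ^ 2" "q ^ Suc (2 * s) = Q ^ 2 * q" "q ^ Suc (Suc (2 * s)) = Q ^ 2 * q ^ 2"
    by (simp_all add: Q_def power2_eq_square mult_2 power_add)
  \<comment> \<open>\<open>z\<close> stands for \<open>q^(2s-1)\<close>. At \<open>s = 0\<close>
    truncated subtraction would give 1 instead of \<open>1/q\<close> and break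
    \<open>z * q = Q^2\<close>; the difference is harmless since \<open>z\<close> only multiplies
    \<open>A1\<close>, which is then 0.\<close>
  define z where "z = (if s = 0 then Q ^ 2 / q else q ^ (2 * s - 1))"
  have zq: "z * q = Q ^ 2"
    unfolding z_def using q by (cases s) (simp_all add: Q_def power2_eq_square power_add mult_2)
  have FK: "formula n m' q = C * ((1 - x * q) * ((1 - x * q ^ 3) * qsum 3 (Suc k) s' q
       - q ^ m' * (1 - q ^ n) * qsum 1 (Suc k) s' q))"
    if "n div 2 = Suc k" "(m' + 1) div 2 = s'" for n m' s'
    unfolding formula_def Let_def that C' using xs by simp
  have Fk: "formula n m' q = C * ((1 - x * q) * qsum 3 k s' q
       - q ^ m' * (1 - q ^ n) * qsum 1 k s' q)"
    if "n div 2 = k" "(m' + 1) div 2 = s'" for n m' s'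
    unfolding formula_def Let_def that C_def using xs by simp
  define w where "w = q ^ (2 * s - 1)"
  have zA1: "w * A1 = z * A1"
    by (simp add: z_def w_def A1_def)
  have n': "n' = 2 * k \<or> n' = Suc (2 * k)" unfolding k_def by presburger
  have m': "m = Suc (2 * s) \<or> m = Suc (Suc (2 * s))" unfolding s_def using m by presburger
  note alg = A1_def[symmetric] A3_def[symmetric] B1_def[symmetric] B3_def[symmetric]
  have dv: "Suc (Suc (2 * k)) div 2 = Suc k" "Suc (Suc (Suc (2 * k))) div 2 = Suc k"
    "Suc (2 * k) div 2 = k" "2 * k div 2 = k"
    "(Suc (2 * s) + 1) div 2 = Suc s" "(Suc (Suc (2 * s)) + 1) div 2 = Suc s"
    "(2 * s + 1) div 2 = s" "(2 * s - 1 + 1) div 2 = s"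
    by (cases s; simp)+
  show ?thesis
    using n' m'
  proof (elim disjE)
    assume nm: "n' = 2 * k" "m = Suc (2 * s)"
    have e: "Suc n = Suc (Suc (2 * k))" "n = Suc (2 * k)" "n - 1 = 2 * k" "m - 1 = 2 * s" "m - 2 = 2 * s - 1"
      using nm Suc by auto
    show ?thesis
      unfolding e(3) unfolding e unfolding nm(2) unfolding FK[OF dv(1) dv(5)] FK[OF dv(1) dv(8)] Fk[OF dv(3) dv(5)] Fk[OF dv(4) dv(5)]
        Fk[OF dv(3) dv(7)] sums alg xs Qs w_def[symmetric]
      using step_even_odd[OF r zq] zA1 by Groebner_Basis.algebra
  next
    assume nm: "n' = 2 * k" "m = Suc (Suc (2 * s))"
    have e: "Suc n = Suc (Suc (2 * k))" "n = Suc (2 * k)" "n - 1 = 2 * k" "m - 1 = Suc (2 * s)" "m - 2 = 2 * s"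
      using nm Suc by auto
    show ?thesis
      unfolding e(3) unfolding e unfolding nm(2) unfolding FK[OF dv(1) dv(6)] FK[OF dv(1) dv(7)] Fk[OF dv(3) dv(6)] Fk[OF dv(4) dv(6)]
        Fk[OF dv(3) dv(5)] sums alg xs Qs
      using step_even_even[OF r] by Groebner_Basis.algebra
  next
    assume nm: "n' = Suc (2 * k)" "m = Suc (2 * s)"
    have e: "Suc n = Suc (Suc (Suc (2 * k)))" "n = Suc (Suc (2 * k))" "n - 1 = Suc (2 * k)"
      "m - 1 = 2 * s" "m - 2 = 2 * s - 1"
      using nm Suc by auto
    show ?thesis
      unfolding e(3) unfolding e unfolding nm(2) unfolding FK[OF dv(2) dv(5)] FK[OF dv(2) dv(8)] FK[OF dv(1) dv(5)] Fk[OF dv(3) dv(5)]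
        FK[OF dv(1) dv(7)] sums alg xs Qs w_def[symmetric]
      using step_odd_odd[OF r zq] zA1 by Groebner_Basis.algebra
  next
    assume nm: "n' = Suc (2 * k)" "m = Suc (Suc (2 * s))"
    have e: "Suc n = Suc (Suc (Suc (2 * k)))" "n = Suc (Suc (2 * k))" "n - 1 = Suc (2 * k)"
      "m - 1 = Suc (2 * s)" "m - 2 = 2 * s"
      using nm Suc by auto
    show ?thesis
      unfolding e(3) unfolding e unfolding nm(2) unfolding FK[OF dv(2) dv(6)] FK[OF dv(2) dv(7)] FK[OF dv(1) dv(6)] Fk[OF dv(3) dv(6)]
        FK[OF dv(1) dv(5)] sums alg xs Qs
      using step_odd_even[OF r] by Groebner_Basis.algebra
  qed
qed

lemma T_beta_eq_qsum:
  assumes "0 < q" "q < 1"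
  shows "T_beta \<beta> k s q = qsum \<beta> k (Suc s) q"
proof (cases k)
  case 0
  have "qsum \<beta> 0 (Suc s) q = 1"
    by (induction s) (use assms in \<open>simp_all add: qsum_Suc\<close>)
  then show ?thesis by (simp add: 0 T_beta_def)
next
  case (Suc l)
  then show ?thesis
    by (simp add: T_beta_def qsum_def qbinom_def atLeast0AtMost lessThan_Suc_atMost)
qed

subsection \<open>Averages over residues, vectors and symmetric matrices\<close>

definition avg :: "nat \<Rightarrow> (int \<Rightarrow> real) \<Rightarrow> real" where
  "avg M f = (\<Sum>i<M. f (int i + 1)) / real M"

text \<open>Nesting one-variable averages lets an induction peel off coordinate 0;
  \<open>case_nat a v\<close> is \<open>v\<close> with \<open>a\<close> prepended.\<close>

primrec avg_vec :: "nat \<Rightarrow> nat \<Rightarrow> ((nat \<Rightarrow> int) \<Rightarrow> real) \<Rightarrow> real" where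
  "avg_vec 0 M f = f (\<lambda>_. 0)"
| "avg_vec (Suc n) M f = avg M (\<lambda>a. avg_vec n M (\<lambda>v. f (case_nat a v)))"

text \<open>Entry \<open>a\<close>, first row \<open>v\<close> and first column \<open>w\<close> added to \<open>Z\<close>. Matrices are functions of which
  only the entries with small indices matter.\<close>
definition border :: "int \<Rightarrow> (nat \<Rightarrow> int) \<Rightarrow> (nat \<Rightarrow> int) \<Rightarrow> (nat \<Rightarrow> nat \<Rightarrow> int) \<Rightarrow> nat \<Rightarrow> nat \<Rightarrow> int" where
  "border a v w Z = case_nat (case_nat a v) (\<lambda>i. case_nat (w i) (Z i))"

lemma border_simps [simp]:
  "border a v w Z 0 0 = a" "border a v w Z 0 (Suc j) = v j"
  "border a v w Z (Suc i) 0 = w i" "border a v w Z (Suc i) (Suc j) = Z i j"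
  by (simp_all add: border_def)

lemma matrix_eqI:
  fixes A B :: "nat \<Rightarrow> nat \<Rightarrow> 'a"
  assumes "A 0 0 = B 0 0" "\<And>j. A 0 (Suc j) = B 0 (Suc j)" "\<And>i. A (Suc i) 0 = B (Suc i) 0"
    "\<And>i j. A (Suc i) (Suc j) = B (Suc i) (Suc j)"
  shows "A = B"
proof (intro ext)
  fix i j show "A i j = B i j"
    by (cases i; cases j; simp add: assms)
qed

text \<open>Bordering keeps the first row outermost, so pivoting on it concerns only the innermost
  average over \<open>Z\<close>.\<close>

primrec avg_sym :: "nat \<Rightarrow> nat \<Rightarrow> ((nat \<Rightarrow> nat \<Rightarrow> int) \<Rightarrow> real) \<Rightarrow> real" where
  "avg_sym 0 M f = f (\<lambda>_ _. 0)"
| "avg_sym (Suc n) M f = avg M (\<lambda>a. avg_vec n M (\<lambda>v. avg_sym n M (\<lambda>Z. f (border a v v Z))))"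

definition periodic :: "nat \<Rightarrow> (int \<Rightarrow> real) \<Rightarrow> bool" where
  "periodic M f \<longleftrightarrow> (\<forall>x y. [x = y] (mod int M) \<longrightarrow> f x = f y)"

definition periodic_vec :: "nat \<Rightarrow> nat \<Rightarrow> ((nat \<Rightarrow> int) \<Rightarrow> real) \<Rightarrow> bool" where
  "periodic_vec n M f \<longleftrightarrow> (\<forall>v w. (\<forall>i<n. [v i = w i] (mod int M)) \<longrightarrow> f v = f w)"

definition periodic_mat :: "nat \<Rightarrow> nat \<Rightarrow> ((nat \<Rightarrow> nat \<Rightarrow> int) \<Rightarrow> real) \<Rightarrow> bool" where
  "periodic_mat n M f \<longleftrightarrow> (\<forall>A B. (\<forall>i<n. \<forall>j<n. [A i j = B i j] (mod int M)) \<longrightarrow> f A = f B)"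

lemma periodicD: "periodic M f \<Longrightarrow> [x = y] (mod int M) \<Longrightarrow> f x = f y"
  by (simp add: periodic_def)

lemma periodic_vec_case_nat:
  assumes "periodic_vec (Suc n) M f"
  shows "periodic_vec n M (\<lambda>v. f (case_nat a v))"
    and "periodic M (\<lambda>a. avg_vec n N (\<lambda>v. f (case_nat a v)))"
proof -
  have *: "f (case_nat a v) = f (case_nat b w)" if "[a = b] (mod int M)" "\<forall>i<n. [v i = w i] (mod int M)" for a b v w
  proof -
    have "[case_nat a v i = case_nat b w i] (mod int M)" if "i < Suc n" for i
      using that \<open>[a = b] (mod int M)\<close> \<open>\<forall>i<n. [v i = w i] (mod int M)\<close> by (cases i) auto
    then show ?thesis using assms unfolding periodic_vec_def by blast
  qed
  show "periodic_vec n M (\<lambda>v. f (case_nat a v))"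
    unfolding periodic_vec_def by (intro allI impI *) simp_all
  show "periodic M (\<lambda>a. avg_vec n N (\<lambda>v. f (case_nat a v)))"
    unfolding periodic_def by (intro allI impI arg_cong[where f = "avg_vec n N"] ext *) simp_all
qed

lemma periodic_mat_border:
  assumes "periodic_mat (Suc n) M f"
  shows "periodic_mat n M (\<lambda>Z. f (border a v w Z))"
    and "periodic_vec n M (\<lambda>v. avg_sym n N (\<lambda>Z. f (border a v v Z)))"
    and "periodic M (\<lambda>a. avg_vec n K (\<lambda>v. avg_sym n N (\<lambda>Z. f (border a v v Z))))"
proof -
  have *: "f (border a v w Z) = f (border a' v' w' Z')" if "[a = a'] (mod int M)" "\<forall>i<n. [v i = v' i] (mod int M)"
    "\<forall>i<n. [w i = w' i] (mod int M)" "\<forall>i<n. \<forall>j<n. [Z i j = Z' i j] (mod int M)" for a v w Z a' v' w' Z'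
  proof -
    have "[border a v w Z i j = border a' v' w' Z' i j] (mod int M)" if "i < Suc n" "j < Suc n" for i j
      using that \<open>[a = a'] (mod int M)\<close> \<open>\<forall>i<n. [v i = v' i] (mod int M)\<close>
        \<open>\<forall>i<n. [w i = w' i] (mod int M)\<close> \<open>\<forall>i<n. \<forall>j<n. [Z i j = Z' i j] (mod int M)\<close>
      by (cases i; cases j) auto
    then show ?thesis using assms unfolding periodic_mat_def by blast
  qed
  show "periodic_mat n M (\<lambda>Z. f (border a v w Z))"
    unfolding periodic_mat_def by (intro allI impI *) simp_all
  show "periodic_vec n M (\<lambda>v. avg_sym n N (\<lambda>Z. f (border a v v Z)))"
    unfolding periodic_vec_def by (intro allI impI arg_cong[where f = "avg_sym n N"] ext *) simp_all
  show "periodic M (\<lambda>a. avg_vec n K (\<lambda>v. avg_sym n N (\<lambda>Z. f (border a v v Z))))"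
    unfolding periodic_def
    by (intro allI impI arg_cong[where f = "avg_vec n K"] arg_cong[where f = "avg_sym n N"] ext *) simp_all
qed

lemma periodic_mat_dvd:
  assumes "periodic_mat n m f" "m dvd M"
  shows "periodic_mat n M f"
  unfolding periodic_mat_def
proof (intro allI impI)
  fix A B :: "nat \<Rightarrow> nat \<Rightarrow> int"
  assume "\<forall>i<n. \<forall>j<n. [A i j = B i j] (mod int M)"
  then have "\<forall>i<n. \<forall>j<n. [A i j = B i j] (mod int m)"
    using assms(2) cong_dvd_modulus[of _ _ "int M" "int m"] by simp
  then show "f A = f B"
    using assms(1) unfolding periodic_mat_def by blast
qed

section \<open>Change of modulus, translation and divisibility by p under averages\<close>

lemma avg_const [simp]: "M > 0 \<Longrightarrow> avg M (\<lambda>_. c) = c"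
  by (simp add: avg_def)

lemma avg_vec_const [simp]: "M > 0 \<Longrightarrow> avg_vec n M (\<lambda>_. c) = c"
  by (induction n) auto

lemma avg_sym_const [simp]: "M > 0 \<Longrightarrow> avg_sym n M (\<lambda>_. c) = c"
  by (induction n) auto

lemma avg_linear: "avg M (\<lambda>x. a + b * f x) = a + b * avg M f" if "M > 0"
  using that by (simp add: avg_def sum.distrib sum_distrib_left[symmetric] field_simps)

lemma sum_lessThan_mult:
  fixes f :: "nat \<Rightarrow> 'a::comm_monoid_add"
  shows "(\<Sum>i<d * M. f i) = (\<Sum>m<d. \<Sum>i<M. f (m * M + i))"
proof -
  have "(\<Sum>i\<in>{k..<k + M}. f i) = (\<Sum>i<M. f (k + i))" for k
    by (rule sum.reindex_bij_witness[of _ "\<lambda>i. k + i" "\<lambda>i. i - k"]) auto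
  moreover have "(\<Sum>i<d * M. f i) = (\<Sum>m<d. \<Sum>i\<in>{m * M..<m * M + M}. f i)"
    by (rule sum.nat_group[symmetric])
  ultimately show ?thesis by simp
qed

text \<open>The \<open>d * M\<close> arguments form \<open>d\<close> runs, each a full
  period.\<close>

lemma avg_mult:
  assumes "periodic M f" "d > 0"
  shows "avg (d * M) f = avg M f"
proof -
  have "(\<Sum>i<d * M. f (int i + 1)) = (\<Sum>m<d. \<Sum>i<M. f (int (m * M + i) + 1))"
    by (rule sum_lessThan_mult)
  also have "\<dots> = (\<Sum>m<d. \<Sum>i<M. f (int i + 1))"
    by (intro sum.cong refl periodicD[OF assms(1)]) (simp add: cong_iff_dvd_diff)
  finally show ?thesis using assms(2) by (simp add: avg_def)
qed

text \<open>A shift by one trades the first value of a period for the value \<open>M\<close> places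
  later, which is equal; any \<open>c\<close> may be replaced by its natural residue.\<close>

lemma avg_shift:
  assumes "periodic M f"
  shows "avg M (\<lambda>x. f (x + c)) = avg M f"
proof (cases "M = 0")
  case False
  have step: "avg M (\<lambda>x. f (x + int k)) = avg M f" for k
  proof (induction k)
    case (Suc k)
    have "(\<Sum>i<M. f (int i + 1 + int (Suc k))) + f (1 + int k) = (\<Sum>i<Suc M. f (int i + 1 + int k))"
      unfolding sum.lessThan_Suc_shift by (simp add: add_ac)
    moreover have "f (int M + 1 + int k) = f (1 + int k)"
      by (rule periodicD[OF assms]) (simp add: cong_iff_dvd_diff)
    ultimately show ?case using Suc.IH by (simp add: avg_def)
  qed simp
  have "f (x + c) = f (x + int (nat (c mod int M)))" for x
    by (rule periodicD[OF assms]) (use False in \<open>simp add: cong_def mod_simps\<close>)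
  then show ?thesis using step[of "nat (c mod int M)"] by simp
qed (simp add: avg_def)

text \<open>Cut \<open>1..p*M\<close> into \<open>M\<close> blocks of length \<open>p\<close>. Only
  the last element of each block is a multiple of \<open>p\<close>, and these are \<open>p\<close>
  times \<open>1..M\<close>.\<close>

lemma avg_split:
  assumes "p > 0" "M > 0" and c: "\<And>x. \<not> int p dvd x \<Longrightarrow> f x = c"
  shows "avg (p * M) f = (1 - 1 / p) * c + (1 / p) * avg M (\<lambda>x. f (int p * x))"
proof -
  obtain p' where p': "p = Suc p'" using assms(1) by (cases p) auto
  have "(\<Sum>i<M * p. f (int i + 1)) = (\<Sum>m<M. \<Sum>i<Suc p'. f (int (m * p + i) + 1))"
    unfolding p' by (rule sum_lessThan_mult)
  also have "\<dots> = (\<Sum>m<M. real p' * c + f (int p * (int m + 1)))"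
  proof (rule sum.cong[OF refl])
    fix m
    have "f (int (m * p + i) + 1) = c" if "i < p'" for i
    proof (rule c)
      have "\<not> int p dvd int i + 1"
        using that zdvd_not_zless[of "int i + 1" "int p"] by (auto simp: p')
      moreover have "int (m * p + i) + 1 = int p * int m + (int i + 1)" by simp
      ultimately show "\<not> int p dvd int (m * p + i) + 1"
        by (metis dvd_add_times_triv_left_iff mult.commute)
    qed
    then show "(\<Sum>i<Suc p'. f (int (m * p + i) + 1)) = real p' * c + f (int p * (int m + 1))"
      by (simp add: p' algebra_simps)
  qed
  also have "\<dots> = real M * (real p' * c) + (\<Sum>m<M. f (int p * (int m + 1)))"
    by (simp add: sum.distrib)
  finally have sum: "(\<Sum>i<p * M. f (int i + 1)) = real M * ((real p - 1) * c) + (\<Sum>m<M. f (int p * (int m + 1)))"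
    by (simp add: p' mult.commute)
  show ?thesis
    unfolding avg_def sum using assms(1,2) by (simp add: field_simps)
qed

lemma avg_vec_mult:
  assumes "periodic_vec n M f" "d > 0"
  shows "avg_vec n (d * M) f = avg_vec n M f"
  using assms(1)
proof (induction n arbitrary: f)
  case (Suc n)
  have "avg_vec (Suc n) (d * M) f = avg (d * M) (\<lambda>a. avg_vec n M (\<lambda>v. f (case_nat a v)))"
    using Suc.IH[OF periodic_vec_case_nat(1)[OF Suc.prems]] by simp
  also have "\<dots> = avg_vec (Suc n) M f"
    using avg_mult[OF periodic_vec_case_nat(2)[OF Suc.prems] assms(2)] by simp
  finally show ?case .
qed simp

lemma avg_vec_shift:
  assumes "periodic_vec n M f"
  shows "avg_vec n M (\<lambda>v. f (\<lambda>i. v i + c i)) = avg_vec n M f"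
  using assms
proof (induction n arbitrary: f c)
  case 0
  then show ?case unfolding periodic_vec_def avg_vec.simps by blast
next
  case (Suc n)
  have "(\<lambda>i. case_nat a v i + c i) = case_nat (a + c 0) (\<lambda>i. v i + c (Suc i))" for a v
    by (rule ext) (auto split: nat.splits)
  then have "avg_vec (Suc n) M (\<lambda>v. f (\<lambda>i. v i + c i))
      = avg M (\<lambda>a. avg_vec n M (\<lambda>v. f (case_nat (a + c 0) v)))"
    using Suc.IH[OF periodic_vec_case_nat(1)[OF Suc.prems]] by simp
  also have "\<dots> = avg_vec (Suc n) M f"
    using avg_shift[OF periodic_vec_case_nat(2)[OF Suc.prems]] by simp
  finally show ?case .
qed

text \<open>Condition on coordinate 0: a non-multiple of \<open>p\<close> already forces the value
  \<open>c\<close>, and a multiple leaves the same question for the remaining coordinates.\<close>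

lemma avg_vec_split:
  assumes pM: "p > 0" "M > 0" and c: "\<And>v. \<exists>i<n. \<not> int p dvd v i \<Longrightarrow> f v = c"
  shows "avg_vec n (p * M) f = (1 - (1 / p) ^ n) * c + (1 / p) ^ n * avg_vec n M (\<lambda>v. f (\<lambda>i. int p * v i))"
  using c
proof (induction n arbitrary: f)
  case (Suc n)
  have eq: "(\<lambda>i. int p * case_nat b v i) = case_nat (int p * b) (\<lambda>i. int p * v i)" for b v
    by (rule ext) (auto split: nat.splits)
  have "avg_vec n (p * M) (\<lambda>v. f (case_nat a v)) = c" if "\<not> int p dvd a" for a
  proof -
    have "f (case_nat a v) = c" for v
      by (rule Suc.prems, rule exI[of _ 0]) (use that in auto)
    then show ?thesis using pM by simp
  qed
  moreover have "avg_vec n (p * M) (\<lambda>v. f (case_nat a v))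
      = (1 - (1 / p) ^ n) * c + (1 / p) ^ n * avg_vec n M (\<lambda>v. f (case_nat a (\<lambda>i. int p * v i)))" for a
    by (rule Suc.IH, rule Suc.prems) (metis Suc_less_eq nat.simps(5))
  ultimately have "avg_vec (Suc n) (p * M) f = (1 - 1 / p) * c + (1 / p) * avg M (\<lambda>b. (1 - (1 / p) ^ n) * c
      + (1 / p) ^ n * avg_vec n M (\<lambda>v. f (case_nat (int p * b) (\<lambda>i. int p * v i))))"
    using avg_split[OF pM, of "\<lambda>a. avg_vec n (p * M) (\<lambda>v. f (case_nat a v))" c] by simp
  also have "\<dots> = (1 - 1 / p) * c + (1 / p) * ((1 - (1 / p) ^ n) * c
      + (1 / p) ^ n * avg_vec (Suc n) M (\<lambda>v. f (\<lambda>i. int p * v i)))"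
    unfolding avg_vec.simps eq avg_linear[OF pM(2)] ..
  finally have "avg_vec (Suc n) (p * M) f = (1 - 1 / p) * c + (1 / p) * ((1 - (1 / p) ^ n) * c
      + (1 / p) ^ n * avg_vec (Suc n) M (\<lambda>v. f (\<lambda>i. int p * v i)))" .
  then show ?case by (simp add: algebra_simps)
qed simp

lemma avg_sym_mult:
  assumes "periodic_mat n M f" "d > 0"
  shows "avg_sym n (d * M) f = avg_sym n M f"
  using assms(1)
proof (induction n arbitrary: f)
  case (Suc n)
  have "avg_sym (Suc n) (d * M) f = avg (d * M) (\<lambda>a. avg_vec n (d * M) (\<lambda>v. avg_sym n M (\<lambda>Z. f (border a v v Z))))"
    using Suc.IH[OF periodic_mat_border(1)[OF Suc.prems]] by simp
  also have "\<dots> = avg (d * M) (\<lambda>a. avg_vec n M (\<lambda>v. avg_sym n M (\<lambda>Z. f (border a v v Z))))"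
    using avg_vec_mult[OF periodic_mat_border(2)[OF Suc.prems] assms(2)] by simp
  also have "\<dots> = avg_sym (Suc n) M f"
    using avg_mult[OF periodic_mat_border(3)[OF Suc.prems] assms(2)] by simp
  finally show ?case .
qed simp

text \<open>Translations are removed from the innermost average outwards. Symmetry of
  \<open>S\<close> keeps the translated matrix of the form \<open>border a v v Z\<close>. This
  absorbs the corrections of Schur complements.\<close>

lemma avg_sym_shift:
  assumes "periodic_mat n M f" "\<And>i j. S i j = S j i"
  shows "avg_sym n M (\<lambda>Z. f (\<lambda>i j. Z i j + S i j)) = avg_sym n M f"
  using assms
proof (induction n arbitrary: f S)
  case 0
  then show ?case unfolding periodic_mat_def avg_sym.simps by blast
next
  case (Suc n)
  define S' c where "S' i j = S (Suc i) (Suc j)" and "c i = S 0 (Suc i)" for i j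
  have sym: "S' i j = S' j i" for i j using Suc.prems(2) by (simp add: S'_def)
  have "(\<lambda>i j. border a v v Z i j + S i j) = border (a + S 0 0) (\<lambda>i. v i + c i) (\<lambda>i. v i + c i) (\<lambda>i j. Z i j + S' i j)" for a v Z
    using Suc.prems(2)[of "Suc _" 0] by (intro matrix_eqI) (simp_all add: S'_def c_def)
  then have "avg_sym (Suc n) M (\<lambda>Z. f (\<lambda>i j. Z i j + S i j))
      = avg M (\<lambda>a. avg_vec n M (\<lambda>v. avg_sym n M (\<lambda>Z. f (border (a + S 0 0) (\<lambda>i. v i + c i) (\<lambda>i. v i + c i) Z))))"
    by (simp only: avg_sym.simps Suc.IH[OF periodic_mat_border(1)[OF Suc.prems(1)] sym])
  also have "\<dots> = avg M (\<lambda>a. avg_vec n M (\<lambda>v. avg_sym n M (\<lambda>Z. f (border (a + S 0 0) v v Z))))"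
    using avg_vec_shift[OF periodic_mat_border(2)[OF Suc.prems(1)]] by simp
  also have "\<dots> = avg_sym (Suc n) M f"
    using avg_shift[OF periodic_mat_border(3)[OF Suc.prems(1)]] by simp
  finally show ?case .
qed

section \<open>Nested averages as normalised sums over finite sets\<close>

text \<open>Entries out of range are pinned to 0, so that each vector has exactly one representing
  function; likewise for \<open>sym_box\<close>.\<close>

definition vec_box :: "nat \<Rightarrow> nat \<Rightarrow> (nat \<Rightarrow> int) set" where
  "vec_box n M = {v. (\<forall>i<n. v i \<in> {1..int M}) \<and> (\<forall>i\<ge>n. v i = 0)}"

definition sym_box :: "nat \<Rightarrow> nat \<Rightarrow> (nat \<Rightarrow> nat \<Rightarrow> int) set" where
  "sym_box n M = {Z. (\<forall>i j. Z i j = Z j i) \<and> (\<forall>i<n. \<forall>j<n. Z i j \<in> {1..int M}) \<and> (\<forall>i j. i \<ge> n \<longrightarrow> Z i j = 0)}"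

lemma avg_eq_sum: "avg M f = (\<Sum>x\<in>{1..int M}. f x) / real M"
proof -
  have "(\<Sum>i<M. f (int i + 1)) = (\<Sum>x\<in>{1..int M}. f x)"
    by (rule sum.reindex_bij_witness[where j = "\<lambda>i. int i + 1" and i = "\<lambda>x. nat (x - 1)"]) auto
  then show ?thesis by (simp add: avg_def)
qed

lemma avg_vec_eq_sum: "avg_vec n M f = (\<Sum>v\<in>vec_box n M. f v) / real M ^ n"
proof (induction n arbitrary: f)
  case 0
  have "vec_box 0 M = {\<lambda>_. 0}" by (auto simp: vec_box_def)
  then show ?case by simp
next
  case (Suc n)
  have "(\<Sum>a\<in>{1..int M}. \<Sum>v\<in>vec_box n M. f (case_nat a v)) = (\<Sum>(a, v)\<in>{1..int M} \<times> vec_box n M. f (case_nat a v))"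
    by (rule sum.cartesian_product)
  also have "\<dots> = (\<Sum>v\<in>vec_box (Suc n) M. f v)"
    by (rule sum.reindex_bij_witness[where j = "\<lambda>(a, v). case_nat a v" and i = "\<lambda>v. (v 0, \<lambda>i. v (Suc i))"])
      (auto simp: vec_box_def split: nat.splits)
  finally show ?case
    by (simp add: avg_eq_sum Suc.IH sum_divide_distrib[symmetric] mult.commute)
qed

text \<open>The normalising constant stays anonymous; where its value matters, averaging the
  constant 1 recovers it.\<close>

lemma avg_sym_eq_sum: "\<exists>K. \<forall>f. avg_sym n M f = (\<Sum>Z\<in>sym_box n M. f Z) / real K"
proof (induction n)
  case 0
  have "sym_box 0 M = {\<lambda>_ _. 0}" by (auto simp: sym_box_def intro!: ext)
  then show ?case by (intro exI[of _ 1]) simp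
next
  case (Suc n)
  then obtain K where K: "\<And>f. avg_sym n M f = (\<Sum>Z\<in>sym_box n M. f Z) / real K" by blast
  have "(\<Sum>a\<in>{1..int M}. \<Sum>v\<in>vec_box n M. \<Sum>Z\<in>sym_box n M. f (border a v v Z)) = (\<Sum>Z\<in>sym_box (Suc n) M. f Z)"
    for f :: "(nat \<Rightarrow> nat \<Rightarrow> int) \<Rightarrow> real"
  proof -
    have "(\<Sum>a\<in>{1..int M}. \<Sum>v\<in>vec_box n M. \<Sum>Z\<in>sym_box n M. f (border a v v Z))
        = (\<Sum>(a, v, Z)\<in>{1..int M} \<times> vec_box n M \<times> sym_box n M. f (border a v v Z))"
      unfolding sum.cartesian_product by (simp add: case_prod_unfold)
    also have "\<dots> = (\<Sum>Z\<in>sym_box (Suc n) M. f Z)"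
    proof (rule sum.reindex_bij_witness[where j = "\<lambda>(a, v, Z). border a v v Z"
        and i = "\<lambda>A. (A 0 0, \<lambda>i. A 0 (Suc i), \<lambda>i j. A (Suc i) (Suc j))"], goal_cases)
      case (2 x)
      then show ?case by (auto simp: sym_box_def vec_box_def border_def split: nat.splits)
    next
      case (3 A)
      then have "A (Suc i) 0 = A 0 (Suc i)" for i by (simp add: sym_box_def)
      then show ?case by (auto intro!: matrix_eqI)
    next
      case (4 A)
      then show ?case by (auto simp: sym_box_def vec_box_def)
    qed (auto simp: sym_box_def vec_box_def)
    finally show ?thesis .
  qed
  then show ?case
    by (intro exI[of _ "M * M ^ n * K"])
      (simp add: avg_eq_sum avg_vec_eq_sum K sum_divide_distrib[symmetric] mult_ac)
qed

lemma bij_betw_sym_box_sym_mats: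
  "bij_betw (\<lambda>Z. mat n n (\<lambda>(i, j). Z i j)) (sym_box n M) (sym_mats n M)"
proof (rule bij_betw_byWitness[where f' = "\<lambda>A i j. if i < n \<and> j < n then A $$ (i, j) else 0"])
  show "\<forall>Z\<in>sym_box n M. (\<lambda>i j. if i < n \<and> j < n then mat n n (\<lambda>(i, j). Z i j) $$ (i, j) else 0) = Z"
    by (intro ballI ext) (auto simp: sym_box_def, (metis leI)+)
qed (auto simp: sym_box_def sym_mats_def)

lemma sum_sym_mats_eq_avg_sym:
  assumes "M > 0"
  shows "(\<Sum>A\<in>sym_mats n M. f A) / real (card (sym_mats n M)) = avg_sym n M (\<lambda>Z. f (mat n n (\<lambda>(i, j). Z i j)))"
proof -
  obtain K where K: "\<And>f. avg_sym n M f = (\<Sum>Z\<in>sym_box n M. f Z) / real K"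
    using avg_sym_eq_sum by blast
  have *: "avg_sym n M (\<lambda>Z. f (mat n n (\<lambda>(i, j). Z i j))) = (\<Sum>A\<in>sym_mats n M. f A) / real K" for f
    unfolding K using sum.reindex_bij_betw[OF bij_betw_sym_box_sym_mats, of f n M] by simp
  \<comment> \<open>The constant function has average 1, which identifies \<open>K\<close> with the
    number of matrices.\<close>
  from *[of "\<lambda>_. 1"] have "real (card (sym_mats n M)) = real K"
    using assms by (auto simp: divide_simps split: if_splits)
  with * show ?thesis by simp
qed

text \<open>A simultaneous swap of two rows and columns is an involution of the box. The sum shows
  this invariance; the nested average treats the indices unequally.\<close>

lemma avg_sym_transpose:
  assumes "i < n" "j < n"
  shows "avg_sym n M (\<lambda>Z. f (\<lambda>k l. Z (transpose i j k) (transpose i j l))) = avg_sym n M f"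
proof -
  obtain K where K: "\<And>f. avg_sym n M f = (\<Sum>Z\<in>sym_box n M. f Z) / real K"
    using avg_sym_eq_sum by blast
  have lt: "transpose i j k < n \<longleftrightarrow> k < n" for k
    using assms by (auto simp: transpose_def)
  have mem: "(\<lambda>k l. Z (transpose i j k) (transpose i j l)) \<in> sym_box n M" if "Z \<in> sym_box n M" for Z
    using that by (auto simp: sym_box_def lt simp flip: not_less)
  show ?thesis unfolding K
    by (rule arg_cong[where f = "\<lambda>x. x / real K"],
        rule sum.reindex_bij_witness[where i = "\<lambda>Z k l. Z (transpose i j k) (transpose i j l)"
          and j = "\<lambda>Z k l. Z (transpose i j k) (transpose i j l)"]) (auto intro: mem)
qed

subsection \<open>Determinants and pivots modulo m\<close>

definition det_fun :: "nat \<Rightarrow> (nat \<Rightarrow> nat \<Rightarrow> int) \<Rightarrow> int" where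
  "det_fun n A = det (mat n n (\<lambda>(i, j). A i j))"

lemma det_fun_0 [simp]: "det_fun 0 A = 1"
  by (simp add: det_fun_def det_def)

lemma det_fun_expand:
  "det_fun n A = (\<Sum>\<pi>\<in>{\<pi>. \<pi> permutes {0..<n}}. signof \<pi> * (\<Prod>i = 0..<n. A i (\<pi> i)))"
  unfolding det_fun_def det_def'[OF mat_carrier]
  by (intro sum.cong arg_cong2[where f = "(*)"] prod.cong refl) (auto dest: permutes_in_image)

lemma det_fun_cong:
  assumes "\<And>i j. i < n \<Longrightarrow> j < n \<Longrightarrow> [A i j = B i j] (mod m)"
  shows "[det_fun n A = det_fun n B] (mod m)"
  unfolding det_fun_expand
  by (intro cong_sum cong_mult cong_refl cong_prod assms) (auto dest: permutes_in_image)

lemma det_fun_transpose: "det_fun n (\<lambda>i j. A j i) = det_fun n A"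
proof -
  have "mat n n (\<lambda>(i, j). A j i) = transpose_mat (mat n n (\<lambda>(i, j). A i j))"
    by (rule eq_matI) auto
  then show ?thesis unfolding det_fun_def by (simp add: det_transpose[OF mat_carrier])
qed

lemma det_fun_permute_rows:
  assumes "\<pi> permutes {0..<n}"
  shows "det_fun n (\<lambda>i j. A (\<pi> i) j) = signof \<pi> * det_fun n A"
proof -
  have "mat n n (\<lambda>(i, j). A (\<pi> i) j) = mat n n (\<lambda>(i, j). mat n n (\<lambda>(i, j). A i j) $$ (\<pi> i, j))"
    using permutes_in_image[OF assms] by (intro eq_matI) auto
  then show ?thesis unfolding det_fun_def by (simp add: det_permute_rows[OF mat_carrier assms])
qed

text \<open>Rows and columns each contribute the sign of the permutation, and its square is
  1.\<close>

lemma det_fun_permute: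
  assumes "\<pi> permutes {0..<n}"
  shows "det_fun n (\<lambda>i j. A (\<pi> i) (\<pi> j)) = det_fun n A"
proof -
  have "det_fun n (\<lambda>i j. A (\<pi> i) (\<pi> j)) = signof \<pi> * det_fun n (\<lambda>i j. A i (\<pi> j))"
    by (rule det_fun_permute_rows[OF assms])
  also have "det_fun n (\<lambda>i j. A i (\<pi> j)) = det_fun n (\<lambda>i j. A j (\<pi> i))"
    by (rule det_fun_transpose[symmetric])
  also have "\<dots> = signof \<pi> * det_fun n (\<lambda>i j. A j i)"
    by (rule det_fun_permute_rows[OF assms])
  also have "det_fun n (\<lambda>i j. A j i) = det_fun n A"
    by (rule det_fun_transpose)
  finally show ?thesis by (simp add: sign_def)
qed

text \<open>Each Leibniz product contains exactly one entry of row 0.\<close>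

lemma det_fun_scale_row:
  "det_fun (Suc n) (border (c * a) (\<lambda>i. c * v i) w Z) = c * det_fun (Suc n) (border a v w Z)"
proof -
  have "(\<Prod>i = 0..<Suc n. border (c * a) (\<lambda>i. c * v i) w Z i (\<pi> i)) = c * (\<Prod>i = 0..<Suc n. border a v w Z i (\<pi> i))" for \<pi>
    unfolding prod.atLeast0_lessThan_Suc_shift
    by (cases "\<pi> 0") (simp_all add: border_def)
  then show ?thesis unfolding det_fun_expand by (simp add: sum_distrib_left mult_ac)
qed

lemma det_fun_scale_col:
  "det_fun (Suc n) (border (c * a) v (\<lambda>i. c * w i) Z) = c * det_fun (Suc n) (border a v w Z)"
proof -
  have "(\<lambda>i j. border a v w Z j i) = border a w v (\<lambda>i j. Z j i)" for a v w Z
    by (rule matrix_eqI) simp_all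
  then show ?thesis
    using det_fun_scale_row[of n c a w v "\<lambda>i j. Z j i"] det_fun_transpose[of "Suc n" "border _ _ _ _"] by metis
qed

lemma det_fun_border_0: "det_fun (Suc n) (border a v (\<lambda>_. 0) Z) = a * det_fun n Z"
proof -
  let ?A = "mat (Suc n) (Suc n) (\<lambda>(i, j). border a v (\<lambda>_. 0) Z i j)"
  have "det ?A = (\<Sum>i<Suc n. ?A $$ (i, 0) * cofactor ?A i 0)"
    by (rule laplace_expansion_column[OF mat_carrier]) simp
  also have "\<dots> = a * cofactor ?A 0 0"
    unfolding sum.lessThan_Suc_shift by simp
  also have "cofactor ?A 0 0 = det (mat n n (\<lambda>(i, j). Z i j))"
  proof -
    have "mat_delete ?A 0 0 = mat n n (\<lambda>(i, j). Z i j)"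
      by (rule eq_matI) (auto simp: mat_delete_def)
    then show ?thesis by (simp add: cofactor_def)
  qed
  finally show ?thesis by (simp add: det_fun_def)
qed

text \<open>The row operations are left multiplication by the lower unitriangular matrix
  \<open>L\<close>, whose determinant is 1.\<close>

lemma det_fun_add_rows:
  "det_fun (Suc n) (border a v (\<lambda>i. w i - c i * a) (\<lambda>i j. Z i j - c i * v j)) = det_fun (Suc n) (border a v w Z)"
proof -
  define \<delta> :: "nat \<Rightarrow> nat \<Rightarrow> int" where "\<delta> i j = of_bool (i = j)" for i j
  define L where "L = border 1 (\<lambda>_. 0) (\<lambda>i. - c i) \<delta>"
  define A where "A = border a v w Z"
  define B where "B = border a v (\<lambda>i. w i - c i * a) (\<lambda>i j. Z i j - c i * v j)"
  have entry: "(\<Sum>k = 0..<Suc n. L i k * A k j) = B i j" if "i < Suc n" for i j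
    unfolding sum.atLeast0_lessThan_Suc_shift using that
    by (cases i; cases j) (simp_all add: L_def A_def B_def \<delta>_def of_bool_def if_distrib[where f = "\<lambda>x. x * _"] cong: if_cong)
  have "mat (Suc n) (Suc n) (\<lambda>(i, j). B i j) = mat (Suc n) (Suc n) (\<lambda>(i, j). L i j) * mat (Suc n) (Suc n) (\<lambda>(i, j). A i j)"
    by (rule eq_matI) (simp_all add: scalar_prod_def entry del: sum.op_ivl_Suc)
  then have "det_fun (Suc n) B = det_fun (Suc n) L * det_fun (Suc n) A"
    by (simp add: det_fun_def det_mult[OF mat_carrier mat_carrier])
  moreover have "det_fun (Suc n) L = 1"
  proof -
    have "(\<lambda>i j. L j i) = border 1 (\<lambda>i. - c i) (\<lambda>_. 0) \<delta>"
      unfolding L_def by (rule matrix_eqI) (simp_all add: \<delta>_def)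
    then have "det_fun (Suc n) L = det_fun n \<delta>"
      using det_fun_transpose[of "Suc n" L] by (simp add: det_fun_border_0)
    moreover have "mat n n (\<lambda>(i, j). \<delta> i j) = 1\<^sub>m n"
      by (rule eq_matI) (simp_all add: \<delta>_def)
    ultimately show ?thesis by (simp add: det_fun_def)
  qed
  ultimately show ?thesis by (simp add: A_def B_def)
qed

text \<open>Subtract \<open>a' * w i\<close> times the first row from each lower row. As
  \<open>a'\<close> inverts \<open>a\<close> only modulo \<open>m\<close>, the first column is
  cleared only modulo \<open>m\<close>.\<close>

lemma det_fun_schur:
  assumes "[a * a' = 1] (mod m)"
  shows "[det_fun (Suc n) (border a v w Z) = a * det_fun n (\<lambda>i j. Z i j - a' * w i * v j)] (mod m)"
proof -
  have "det_fun (Suc n) (border a v w Z)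
      = det_fun (Suc n) (border a v (\<lambda>i. w i - a' * w i * a) (\<lambda>i j. Z i j - a' * w i * v j))"
    using det_fun_add_rows[of n a v w "\<lambda>i. a' * w i" Z] by simp
  also have "[\<dots> = det_fun (Suc n) (border a v (\<lambda>_. 0) (\<lambda>i j. Z i j - a' * w i * v j))] (mod m)"
  proof (rule det_fun_cong)
    fix i j
    have "w k - a' * w k * a = w k * (1 - a * a')" for k by (simp add: algebra_simps)
    moreover have "m dvd 1 - a * a'" using assms by (simp add: cong_iff_dvd_diff dvd_diff_commute)
    ultimately have "[w k - a' * w k * a = 0] (mod m)" for k by (simp add: cong_0_iff)
    then show "[border a v (\<lambda>i. w i - a' * w i * a) (\<lambda>i j. Z i j - a' * w i * v j) i j
      = border a v (\<lambda>_. 0) (\<lambda>i j. Z i j - a' * w i * v j) i j] (mod m)"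
      by (cases i; cases j) auto
  qed
  finally show ?thesis by (simp only: det_fun_border_0)
qed

section \<open>Nonvanishing of the determinant modulo m, and elimination of pivots\<close>

definition nonzero_ind :: "nat \<Rightarrow> nat \<Rightarrow> (nat \<Rightarrow> nat \<Rightarrow> int) \<Rightarrow> real" where
  "nonzero_ind n m A = of_bool (\<not> int m dvd det_fun n A)"

lemma nonzero_ind_1 [simp]: "nonzero_ind n (Suc 0) = (\<lambda>_. 0)"
  by (rule ext) (simp add: nonzero_ind_def)

lemma nonzero_ind_cong:
  assumes "\<And>i j. i < n \<Longrightarrow> j < n \<Longrightarrow> [A i j = B i j] (mod int m)"
  shows "nonzero_ind n m A = nonzero_ind n m B"
  using cong_dvd_iff[OF det_fun_cong[OF assms]] by (simp add: nonzero_ind_def)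

lemma periodic_nonzero_ind: "periodic_mat n m (nonzero_ind n m)"
  unfolding periodic_mat_def by (auto intro: nonzero_ind_cong)

text \<open>The unit factor \<open>a\<close> does not affect divisibility by \<open>m\<close>. One
  inverse \<open>a'\<close> serves all sizes and borders.\<close>

lemma nonzero_ind_schur:
  assumes "coprime a (int m)"
  obtains a' where "[a * a' = 1] (mod int m)"
    and "\<And>n v w Z. nonzero_ind (Suc n) m (border a v w Z) = nonzero_ind n m (\<lambda>i j. Z i j - a' * w i * v j)"
proof -
  obtain a' where a': "[a * a' = 1] (mod int m)" using assms by (auto simp: coprime_iff_invertible_int)
  have "nonzero_ind (Suc n) m (border a v w Z) = nonzero_ind n m (\<lambda>i j. Z i j - a' * w i * v j)" for n v w Z
    using cong_dvd_iff[OF det_fun_schur[OF a', of n v w Z]]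
      coprime_dvd_mult_right_iff[of "int m" a] assms[unfolded coprime_commute[of a]]
    by (simp add: nonzero_ind_def)
  with a' show ?thesis by (rule that)
qed

lemma nonzero_ind_border_mult:
  assumes "M = p * m" "p > 0" "det_fun (Suc n) A = int p * det_fun (Suc n) B"
  shows "nonzero_ind (Suc n) M A = nonzero_ind (Suc n) m B"
  using assms by (simp add: nonzero_ind_def)

lemma avg_sym_nonzero_ind_dvd:
  assumes "m dvd M" "M > 0"
  shows "avg_sym n M (nonzero_ind n m) = avg_sym n m (nonzero_ind n m)"
proof -
  obtain d where "M = d * m" using assms(1) by (metis dvdE mult.commute)
  with assms(2) show ?thesis using avg_sym_mult[OF periodic_nonzero_ind, of d] by simp
qed

text \<open>The condition on \<open>v\<close> and \<open>w\<close> makes the Schur correction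
  symmetric, so translation invariance removes it. \<open>M\<close> may exceed \<open>m\<close>,
  because \<open>Z\<close> keeps its original modulus after a factor \<open>p\<close> has been taken
  out of the determinant.\<close>

lemma avg_sym_unit_pivot:
  assumes "coprime a (int m)" "m dvd M" "M > 0" "\<And>i j. w i * v j = w j * v i"
  shows "avg_sym n M (\<lambda>Z. nonzero_ind (Suc n) m (border a v w Z)) = avg_sym n m (nonzero_ind n m)"
proof -
  obtain a' where a': "\<And>n v w Z. nonzero_ind (Suc n) m (border a v w Z) = nonzero_ind n m (\<lambda>i j. Z i j - a' * w i * v j)"
    using nonzero_ind_schur[OF assms(1)] by metis
  have "avg_sym n M (\<lambda>Z. nonzero_ind (Suc n) m (border a v w Z))
      = avg_sym n M (\<lambda>Z. nonzero_ind n m (\<lambda>i j. Z i j + - (a' * (w i * v j))))"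
    by (simp add: a' mult.assoc)
  also have "\<dots> = avg_sym n M (nonzero_ind n m)"
    by (rule avg_sym_shift[OF periodic_mat_dvd[OF periodic_nonzero_ind assms(2)]]) (metis assms(4))
  also have "\<dots> = avg_sym n m (nonzero_ind n m)"
    by (rule avg_sym_nonzero_ind_dvd[OF assms(2,3)])
  finally show ?thesis .
qed

lemma coprime_prime_power:
  assumes "prime p" "\<not> int p dvd x"
  shows "coprime x (int (p ^ k))"
proof -
  have "prime (int p)" using assms(1) by simp
  then have "coprime (int p) x" using assms(2) by (rule prime_imp_coprime)
  then show ?thesis by (simp add: coprime_commute)
qed

text \<open>The leading block \<open>[[a, u], [u, b]]\<close> is invertible. Swapping the first two rows makes \<open>u\<close> the
  pivot, after which the next pivot \<open>u - u' a b\<close> is again a unit; modulo \<open>m\<close> the two Schur steps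
  together subtract a symmetric matrix.\<close>
lemma avg_sym_hyperbolic_pivot:
  assumes m: "m = p ^ \<mu>" and p: "prime p" and a: "int p dvd a" and u: "\<not> int p dvd u"
  shows "avg_sym (Suc n) m (\<lambda>Z. nonzero_ind (Suc (Suc n)) m (border a (case_nat u v) (case_nat u v) Z))
       = avg_sym n m (nonzero_ind n m)"
proof -
  have cop: "coprime x (int m)" if "\<not> int p dvd x" for x
    unfolding m by (rule coprime_prime_power[OF p that])
  have m0: "m > 0" using p m by (simp add: prime_gt_0_nat)
  obtain u' where u': "[u * u' = 1] (mod int m)"
    "\<And>n v w Z. nonzero_ind (Suc n) m (border u v w Z) = nonzero_ind n m (\<lambda>i j. Z i j - u' * w i * v j)"
    by (rule nonzero_ind_schur[OF cop[OF u]]) (rule that)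
  have main: "avg_sym n m (\<lambda>Z. nonzero_ind (Suc (Suc n)) m (border a (case_nat u v) (case_nat u v) (border b w w Z)))
     = avg_sym n m (nonzero_ind n m)" for b w
  proof -
    define c where "c = u - u' * a * b"
    have "\<not> int p dvd c"
    proof
      assume "int p dvd c"
      moreover have "int p dvd u' * a * b" using a by simp
      ultimately have "int p dvd c + u' * a * b" by (rule dvd_add)
      then show False using u by (simp add: c_def)
    qed
    then obtain c' where c': "[c * c' = 1] (mod int m)"
      "\<And>n v w Z. nonzero_ind (Suc n) m (border c v w Z) = nonzero_ind n m (\<lambda>i j. Z i j - c' * w i * v j)"
      by (rule nonzero_ind_schur[OF cop]) (rule that)
    \<comment> \<open>The two Schur steps subtract \<open>u' * v i * w j + c' * (w i - u' * b * v i)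
      * (v j - u' * a * w j)\<close>. \<open>S\<close> differs from their effect only in the
      coefficient of \<open>v i * w j\<close>, which is replaced by \<open>- c'\<close>, the
      coefficient of \<open>w i * v j\<close>.\<close>
    define S where "S i j = - c' * (v i * w j + w i * v j) + c' * u' * a * (w i * w j) + c' * u' * b * (v i * v j)" for i j
    have "nonzero_ind (Suc (Suc n)) m (border a (case_nat u v) (case_nat u v) (border b w w Z))
        = nonzero_ind n m (\<lambda>i j. Z i j + S i j)" for Z
    proof -
      let ?A = "border a (case_nat u v) (case_nat u v) (border b w w Z)"
      let ?B = "border u (case_nat b w) (case_nat a v) (border u v w Z)"
      have eq: "(\<lambda>i j. ?A (transpose 0 1 i) j) = ?B"
      proof (rule matrix_eqI, goal_cases)
        case (2 j)
        then show ?case by (cases j) simp_all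
      next
        case (3 i)
        then show ?case by (cases i) simp_all
      next
        case (4 i j)
        then show ?case by (cases i; cases j) simp_all
      qed simp
      have "det_fun (Suc (Suc n)) ?B = signof (transpose 0 1) * det_fun (Suc (Suc n)) ?A"
        unfolding eq[symmetric] by (rule det_fun_permute_rows) (rule permutes_swap_id; simp)
      then have "nonzero_ind (Suc (Suc n)) m ?A = nonzero_ind (Suc (Suc n)) m ?B"
        by (auto simp: nonzero_ind_def sign_def)
      also have "\<dots> = nonzero_ind (Suc n) m (border c (\<lambda>j. v j - u' * a * w j) (\<lambda>i. w i - u' * v i * b)
          (\<lambda>i j. Z i j - u' * v i * w j))"
        unfolding u'(2) by (rule arg_cong[where f = "nonzero_ind (Suc n) m"], rule matrix_eqI) (simp_all add: c_def)
      also have "\<dots> = nonzero_ind n m (\<lambda>i j. Z i j - u' * v i * w j - c' * (w i - u' * v i * b) * (v j - u' * a * w j))"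
        by (rule c'(2))
      also have "\<dots> = nonzero_ind n m (\<lambda>i j. Z i j + S i j)"
      proof (rule nonzero_ind_cong)
        fix i j
        obtain k l where kl: "u * u' - 1 = int m * k" "c * c' - 1 = int m * l"
          using u'(1) c'(1) unfolding cong_iff_dvd_diff dvd_def by blast
        \<comment> \<open>The left-hand side is \<open>u' * (c * c' - 1) - c' * (u * u' - 1)\<close>
          with \<open>c\<close> expanded.\<close>
        have "c' - u' - c' * u' * u' * a * b = int m * (u' * l - c' * k)"
          using kl unfolding c_def by Groebner_Basis.algebra
        moreover have "Z i j - u' * v i * w j - c' * (w i - u' * v i * b) * (v j - u' * a * w j) - (Z i j + S i j)
            = (c' - u' - c' * u' * u' * a * b) * (v i * w j)"
          by (simp add: S_def algebra_simps)
        ultimately show "[Z i j - u' * v i * w j - c' * (w i - u' * v i * b) * (v j - u' * a * w j) = Z i j + S i j] (mod int m)"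
          by (simp add: cong_iff_dvd_diff)
      qed
      finally show ?thesis .
    qed
    moreover have "S i j = S j i" for i j
      by (simp add: S_def algebra_simps)
    ultimately show ?thesis
      by (simp add: avg_sym_shift[OF periodic_nonzero_ind])
  qed
  show ?thesis unfolding avg_sym.simps main using m0 by simp
qed

text \<open>A simultaneous swap of rows and columns brings the unit next to the corner. It preserves
  the determinant and the distribution of \<open>Z\<close>, so the two by two pivot applies.\<close>

lemma avg_sym_unit_in_row:
  assumes m: "m = p ^ \<mu>" and p: "prime p" and a: "int p dvd a" and v: "\<exists>i<n. \<not> int p dvd v i"
  shows "avg_sym n m (\<lambda>Z. nonzero_ind (Suc n) m (border a v v Z))
       = avg_sym (n - 1) m (nonzero_ind (n - 1) m)"
proof -
  obtain i where i: "i < n" "\<not> int p dvd v i" using v by blast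
  then obtain n' where n': "n = Suc n'" by (cases n) auto
  define \<sigma> where "\<sigma> = transpose 0 i"
  define v' where "v' j = v (\<sigma> j)" for j
  have "nonzero_ind (Suc n) m (border a v v Z) = nonzero_ind (Suc n) m (border a v' v' (\<lambda>k l. Z (\<sigma> k) (\<sigma> l)))" for Z
  proof -
    \<comment> \<open>This is \<open>\<sigma>\<close> moved up by one index, since the border
      occupies index 0.\<close>
    let ?\<tau> = "transpose 1 (Suc i)"
    have "?\<tau> (Suc k) = Suc (\<sigma> k)" "?\<tau> 0 = 0" for k by (auto simp: \<sigma>_def transpose_def)
    then have "border a v' v' (\<lambda>k l. Z (\<sigma> k) (\<sigma> l)) = (\<lambda>k l. border a v v Z (?\<tau> k) (?\<tau> l))"
      by (intro matrix_eqI) (simp_all add: v'_def)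
    moreover have "?\<tau> permutes {0..<Suc n}" using i by (intro permutes_swap_id) auto
    ultimately show ?thesis using det_fun_permute by (simp add: nonzero_ind_def)
  qed
  then have "avg_sym n m (\<lambda>Z. nonzero_ind (Suc n) m (border a v v Z))
      = avg_sym n m (\<lambda>Z. nonzero_ind (Suc n) m (border a v' v' Z))"
    using avg_sym_transpose[of 0 n i m "\<lambda>Z. nonzero_ind (Suc n) m (border a v' v' Z)"] i by (simp add: \<sigma>_def)
  moreover have "v' = case_nat (v i) (\<lambda>k. v' (Suc k))"
    by (rule ext) (auto simp: v'_def \<sigma>_def split: nat.splits)
  ultimately show ?thesis
    using avg_sym_hyperbolic_pivot[OF m p a i(2), of n' "\<lambda>k. v' (Suc k)"] by (simp add: n')
qed

section \<open>The probability and its recursion\<close>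

definition prob_nonzero :: "nat \<Rightarrow> nat \<Rightarrow> nat \<Rightarrow> real" where
  "prob_nonzero p n \<mu> = avg_sym n (p ^ \<mu>) (nonzero_ind n (p ^ \<mu>))"

lemma prob_nonzero_eq: "p > 0 \<Longrightarrow> P_nonsing n (p ^ \<mu>) = prob_nonzero p n \<mu>"
proof -
  assume "p > 0"
  let ?M = "p ^ \<mu>"
  \<comment> \<open>For an infinite set, sum and cardinality would both be 0, making the average of
    the constant 1 equal to 0.\<close>
  have "finite (sym_mats n ?M)"
    by (rule ccontr) (use sum_sym_mats_eq_avg_sym[of ?M "\<lambda>_. 1" n] \<open>p > 0\<close> in simp)
  then have "real (card {A \<in> sym_mats n ?M. \<not> int ?M dvd det A}) = (\<Sum>A\<in>sym_mats n ?M. of_bool (\<not> int ?M dvd det A))"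
    by (simp add: Int_def of_bool_def sum.If_cases)
  then show ?thesis
    unfolding P_nonsing_def prob_nonzero_def 
    using sum_sym_mats_eq_avg_sym[of ?M "\<lambda>A. of_bool (\<not> int ?M dvd det A)" n] \<open>p > 0\<close>
    by (simp add: nonzero_ind_def[abs_def] det_fun_def)
qed

lemma prob_nonzero_0_left:
  assumes "prime p" "\<mu> > 0"
  shows "prob_nonzero p 0 \<mu> = 1"
  using assms by (auto simp: prob_nonzero_def nonzero_ind_def prime_nat_iff)

lemma prob_nonzero_0_right [simp]: "prob_nonzero p n 0 = 0"
  by (simp add: prob_nonzero_def)

text \<open>For \<open>\<mu> = 1\<close> the truncated exponents \<open>\<mu> - 1\<close> and \<open>\<mu> - 2\<close> are both 0 and the corresponding
  probabilities vanish, as they should; for \<open>n = 0\<close> the term with \<open>n - 1\<close> has coefficient 0.\<close>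
lemma prob_nonzero_rec:
  assumes p: "prime p" and mu: "\<mu> > 0" and q: "q = 1 / real p"
  shows "prob_nonzero p (Suc n) \<mu> = (1 - q) * prob_nonzero p n \<mu> + q * (1 - q ^ n) * prob_nonzero p (n - 1) \<mu>
     + q ^ Suc n * ((1 - q) * prob_nonzero p n (\<mu> - 1) + q * prob_nonzero p (Suc n) (\<mu> - 2))"
proof -
  obtain \<nu> where \<nu>: "\<mu> = Suc \<nu>" using mu by (cases \<mu>) auto
  have p0: "p > 0" using p by (simp add: prime_gt_0_nat)
  let ?M = "p ^ \<mu>" and ?N = "p ^ \<nu>"
  have M: "?M = p * ?N" "?M > 0" "?N > 0" using p0 by (simp_all add: \<nu>)
  define f where "f a v = avg_sym n ?M (\<lambda>Z. nonzero_ind (Suc n) ?M (border a v v Z))" for a v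
  \<comment> \<open>This is the situation after \<open>p\<close> has been taken out of a first row
    \<open>p * (b, y)\<close>: the modulus drops to \<open>?N\<close>, the first column below the
    corner still carries \<open>p\<close>, and \<open>Z\<close> is still averaged modulo
    \<open>?M\<close>.\<close>
  define g where "g b y = avg_sym n ?M (\<lambda>Z. nonzero_ind (Suc n) ?N (border b y (\<lambda>i. int p * y i) Z))" for b y
  have f_unit: "f a v = prob_nonzero p n \<mu>" if "\<not> int p dvd a" for a v
    unfolding f_def prob_nonzero_def using coprime_prime_power[OF p that] M(2)
    by (intro avg_sym_unit_pivot) (auto simp: mult.commute)
  have f_row: "f (int p * b) v = prob_nonzero p (n - 1) \<mu>" if "\<exists>i<n. \<not> int p dvd v i" for b v
    unfolding f_def prob_nonzero_def by (rule avg_sym_unit_in_row[OF refl p _ that]) simp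
  have f_g: "f (int p * b) (\<lambda>i. int p * y i) = g b y" for b y
    unfolding f_def g_def
    by (intro arg_cong[where f = "avg_sym n ?M"] ext nonzero_ind_border_mult[OF M(1) p0] det_fun_scale_row)
  have g_unit: "g b y = prob_nonzero p n \<nu>" if "\<not> int p dvd b" for b y
    unfolding g_def prob_nonzero_def using coprime_prime_power[OF p that] M
    by (intro avg_sym_unit_pivot) (auto simp: mult.commute)
  have g_avg: "avg ?N (\<lambda>b. avg_vec n ?N (g b)) = (1 - q) * prob_nonzero p n \<nu> + q * prob_nonzero p (Suc n) (\<nu> - 1)"
  proof (cases \<nu>)
    case 0
    have "g = (\<lambda>_ _. 0)" unfolding g_def using 0 p0 by (intro ext) simp
    then show ?thesis by (simp add: 0)
  next
    case (Suc \<kappa>)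
    let ?K = "p ^ \<kappa>"
    have N: "?N = p * ?K" "?K > 0" using p0 by (simp_all add: Suc)
    let ?h = "nonzero_ind (Suc n) ?K"
    have per: "periodic_mat (Suc n) ?K ?h" by (rule periodic_nonzero_ind)
    \<comment> \<open>With the corner also divisible by \<open>p\<close>, the whole first column is,
      and a second \<open>p\<close> comes out, leaving a symmetric matrix modulo
      \<open>?K\<close>.\<close>
    have "g (int p * c) y = avg_sym n ?M (\<lambda>Z. ?h (border c y y Z))" for c y
      unfolding g_def
      by (intro arg_cong[where f = "avg_sym n ?M"] ext nonzero_ind_border_mult[OF N(1) p0] det_fun_scale_col)
    \<comment> \<open>Here \<open>?M = p * p * ?K\<close>, and the integrand has period
      \<open>?K\<close> in \<open>Z\<close>.\<close>
    also have "\<dots> c y = avg_sym n ?K (\<lambda>Z. ?h (border c y y Z))" for c y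
      using avg_sym_mult[OF periodic_mat_border(1)[OF per], of "p * p" c y y] p0 by (simp add: \<nu> Suc mult.assoc)
    finally have "g (int p * c) = (\<lambda>y. avg_sym n ?K (\<lambda>Z. ?h (border c y y Z)))" for c
      by (rule ext)
    then have "avg_vec n ?N (g (int p * c)) = avg_vec n ?K (\<lambda>y. avg_sym n ?K (\<lambda>Z. ?h (border c y y Z)))" for c
      using avg_vec_mult[OF periodic_mat_border(2)[OF per], of p ?K c] p0 by (simp add: Suc)
    then have "avg ?K (\<lambda>c. avg_vec n ?N (g (int p * c))) = prob_nonzero p (Suc n) \<kappa>"
      by (simp add: prob_nonzero_def)
    moreover have "avg_vec n ?N (g b) = prob_nonzero p n \<nu>" if "\<not> int p dvd b" for b
    proof -
      have "g b = (\<lambda>_. prob_nonzero p n \<nu>)" using g_unit[OF that] by (rule ext)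
      then show ?thesis using M(3) by simp
    qed
    ultimately show ?thesis
      unfolding N(1) using avg_split[OF p0 N(2), of "\<lambda>b. avg_vec n ?N (g b)"] by (simp add: q Suc)
  qed
  have "prob_nonzero p (Suc n) \<mu> = avg (p * ?N) (\<lambda>a. avg_vec n (p * ?N) (f a))"
    unfolding prob_nonzero_def avg_sym.simps f_def[abs_def] M(1) ..
  also have "\<dots> = (1 - 1 / p) * prob_nonzero p n \<mu> + 1 / p * avg ?N (\<lambda>b. avg_vec n (p * ?N) (f (int p * b)))"
  proof (rule avg_split[OF p0 M(3)])
    fix a assume "\<not> int p dvd a"
    then have "f a = (\<lambda>_. prob_nonzero p n \<mu>)" using f_unit by (intro ext)
    then show "avg_vec n (p * ?N) (f a) = prob_nonzero p n \<mu>" using M by simp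
  qed
  also have "(\<lambda>b. avg_vec n (p * ?N) (f (int p * b)))
      = (\<lambda>b. (1 - (1 / p) ^ n) * prob_nonzero p (n - 1) \<mu> + (1 / p) ^ n * avg_vec n ?N (g b))"
    using avg_vec_split[OF p0 M(3) f_row] by (simp add: f_g)
  also have "avg ?N \<dots> = (1 - (1 / p) ^ n) * prob_nonzero p (n - 1) \<mu> + (1 / p) ^ n * avg ?N (\<lambda>b. avg_vec n ?N (g b))"
    by (rule avg_linear[OF M(3)])
  finally show ?thesis
    unfolding g_avg q[symmetric] by (simp add: \<nu> algebra_simps)
qed

text \<open>Both sides satisfy the same recursion and agree for \<open>\<mu> = 0\<close> and for
  \<open>n = 0\<close>; every term on its right-hand side has a smaller
  \<open>n + \<mu>\<close>.\<close>

lemma prob_nonzero_eq_formula: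
  assumes "prime p"
  shows "prob_nonzero p n \<mu> = formula n \<mu> (1 / real p)"
proof -
  define q where "q = 1 / real p"
  have q: "0 < q" "q < 1" using prime_gt_1_nat[OF assms] by (simp_all add: q_def)
  have "prob_nonzero p n \<mu> = formula n \<mu> q"
  proof (induction "n + \<mu>" arbitrary: n \<mu> rule: less_induct)
    case less
    show ?case
    proof (cases "\<mu> = 0")
      case True
      then show ?thesis by (simp add: formula_0_right)
    next
      case mu: False
      show ?thesis
      proof (cases n)
        case 0
        then show ?thesis using mu assms q by (simp add: prob_nonzero_0_left formula_0_left)
      next
        case (Suc n')
        have "prob_nonzero p (Suc n') \<mu> = formula (Suc n') \<mu> q"
          using mu less[of n' \<mu>] less[of "n' - 1" \<mu>] less[of n' "\<mu> - 1"] less[of "Suc n'" "\<mu> - 2"]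
          by (simp add: prob_nonzero_rec[OF assms _ q_def] formula_rec[OF q] Suc)
        then show ?thesis by (simp add: Suc)
      qed
    qed
  qed
  then show ?thesis by (simp add: q_def)
qed

theorem theorem5p1:
  fixes p n \<mu> :: nat
  assumes "prime p" and "n \<ge> 1" and "\<mu> \<ge> 1"
  shows "let q = 1 / real p; k = n div 2; s = (\<mu> - 1) div 2 in
    P_nonsing n (p ^ \<mu>) =
      Pi_q (2*k) q / ((1 - q) * Pi_q k (q^2)) *
      ((1 - q ^ (2*k+1)) * T_beta 3 k s q - q ^ \<mu> * (1 - q ^ n) * T_beta 1 k s q)"
proof -
  define q where "q = 1 / real p"
  have q: "0 < q" "q < 1" using prime_gt_1_nat[OF assms(1)] by (simp_all add: q_def)
  have "(\<mu> + 1) div 2 = Suc ((\<mu> - 1) div 2)" using assms(3) by presburger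
  then show ?thesis
    using prob_nonzero_eq[of p n \<mu>] prob_nonzero_eq_formula[OF assms(1), of n \<mu>] assms(1)
    by (simp add: Let_def formula_def T_beta_eq_qsum q prime_gt_0_nat flip: q_def)
qed

end
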